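(* Let $(\mathcal Q,d)$ be a Hadamard space, let $\tau\in\mathcal S_0^+$ with $D:=\lim_{x\to\infty}\tau'(x)<\infty$, let $Y$ be a $\mathcal Q$-valued random variable concentrated on a separable set, let $m$ be a $\tau$-Fréchet mean of $Y$ and let $m_n$ be an empirical $\tau$-Fréchet mean of $n\in\mathbb N$ independent copies $Y_1,\dots,Y_n$ of $Y$. Let $R\in(0,\infty)$ and $\lambda\in(0,1]$ be such that $\tau(R)\ge\lambda DR$. Let $r\in[0,\infty)$ and set $\rho:=\mathbf P(d(Y,m)\le r)$. Let $\eta\in(0,1]$. Assume $(\lambda+1)\eta\rho>1$ and $r\ge\frac12R$. Then $$\mathbf P\left(d(m,m_n)>\frac{(3+\lambda)\eta\rho-1}{(1+\lambda)\eta\rho-1}\,r\right)\le\exp\big(-n\,\mathrm{KL}(\eta\rho,\rho)\big).$$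
   Context: A Hadamard space is a nonempty complete metric space $(\mathcal Q,d)$ such that for all $y_0,y_1\in\mathcal Q$ there is $p\in\mathcal Q$ with $\frac12 d(y_0,q)^2+\frac12 d(y_1,q)^2-\frac14 d(y_0,y_1)^2\ge d(q,p)^2$ for all $q\in\mathcal Q$; it carries its Borel $\sigma$-algebra. "Concentrated on a separable set" means $\mathbf P(Y\in\mathcal Y)=1$ for some separable $\mathcal Y\subset\mathcal Q$. $\mathcal S_0^+$ is the set of nondecreasing convex functions $\tau\colon[0,\infty)\to\mathbb R$ with $\tau(0)=0$ that are differentiable on $(0,\infty)$ with concave derivative $\tau'$ satisfying $\tau'(x)>0$ for all $x>0$. A $\tau$-Fréchet mean of $Y$ is any $m\in\arg\min_{q\in\mathcal Q}\mathbf E[\tau(d(Y,q))-\tau(d(Y,o))]$ with an arbitrary reference point $o\in\mathcal Q$ (independent of $o$; well defined since $\tau'$ is bounded). $m_n\in\arg\min_{q\in\mathcal Q}\sum_{j=1}^n\tau(d(Y_j,q))$ is a measurable function of $(Y_1,\dots,Y_n)$. The binary relative entropy is $\mathrm{KL}(t,p):=t\log\frac tp+(1-t)\log\frac{1-t}{1-p}$ for $t,p\in[0,1]$, with conventions $0\log0=0$ and $\mathrm{KL}(t,p)=+\infty$ if $t\notin\{0,1\}$ and $p\in\{0,1\}$; $\exp(-\infty)=0$. *)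

theory Defs
  imports "HOL-Probability.Probability"
begin

(* The point p (the midpoint of y0 and y1) must serve all q simultaneously.
   Nonemptiness is automatic for types. *)
class hadamard_space = complete_space +
  assumes midpoint_inequality:
    "\<exists>p. \<forall>q. (dist p q)\<^sup>2 \<le> 1/2 * (dist y0 q)\<^sup>2 + 1/2 * (dist y1 q)\<^sup>2 - 1/4 * (dist y0 y1)\<^sup>2"

(* A function on [0,\<infinity>) is represented by a function on all reals; its values on negative
   arguments play no role, since the derivative is only taken at interior points. *)
definition S0_plus :: "(real \<Rightarrow> real) set" where
  "S0_plus = {\<tau>. mono_on {0..} \<tau> \<and> convex_on {0..} \<tau> \<and> \<tau> 0 = 0 \<and>
                  (\<forall>x>0. \<tau> differentiable (at x)) \<and>
                  concave_on {0<..} (deriv \<tau>) \<and>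
                  (\<forall>x>0. deriv \<tau> x > 0)}"

definition concentrated_on_separable ::
    "'b measure \<Rightarrow> ('b \<Rightarrow> 'a::topological_space) \<Rightarrow> bool" where
  "concentrated_on_separable M Y \<longleftrightarrow>
     (\<exists>S. separable_space (top_of_set S) \<and> measure M {\<omega> \<in> space M. Y \<omega> \<in> S} = 1)"

(* The reference point z is arbitrary. If the derivative of \<tau> is bounded, the integrand is
   bounded, so the Bochner integral is a genuine expectation and changing z only adds a
   constant to the objective. *)
definition is_frechet_mean ::
    "'b measure \<Rightarrow> (real \<Rightarrow> real) \<Rightarrow> 'a \<Rightarrow> ('b \<Rightarrow> 'a::metric_space) \<Rightarrow> 'a \<Rightarrow> bool" where
  "is_frechet_mean M \<tau> z Y m \<longleftrightarrow>
     is_arg_min (\<lambda>q. \<integral>\<omega>. (\<tau> (dist (Y \<omega>) q) - \<tau> (dist (Y \<omega>) z)) \<partial>M) (\<lambda>_. True) m"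

definition is_empirical_frechet_mean ::
    "(real \<Rightarrow> real) \<Rightarrow> nat \<Rightarrow> (nat \<Rightarrow> 'a::metric_space) \<Rightarrow> 'a \<Rightarrow> bool" where
  "is_empirical_frechet_mean \<tau> n y m \<longleftrightarrow>
     is_arg_min (\<lambda>q. \<Sum>j\<in>{1..n}. \<tau> (dist (y j) q)) (\<lambda>_. True) m"

(* Relative entropy of Bernoulli(t) with respect to Bernoulli(p), for t, p in [0,1].
   In the real branch 0 log 0 = 0 holds because of the factor 0; (t,p) = (0,1) and (1,0) give
   log (1/0) = \<infinity>, and t = p gives 0 also at the endpoints. *)
definition KL :: "real \<Rightarrow> real \<Rightarrow> ereal" where
  "KL t p = (if (p = 0 \<and> t \<noteq> 0) \<or> (p = 1 \<and> t \<noteq> 1) then \<infinity>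
             else ereal (t * ln (t / p) + (1 - t) * ln ((1 - t) / (1 - p))))"

definition ereal_exp :: "ereal \<Rightarrow> ereal" where
  "ereal_exp x = (case x of ereal y \<Rightarrow> ereal (exp y) | PInfty \<Rightarrow> \<infinity> | MInfty \<Rightarrow> 0)"

end

theory Submission
  imports Defs
begin

text \<open>
  The theorem splits into a deterministic statement about samples and a large deviation bound
  for a binomial count.

  Deterministically (lemma \<open>empirical_frechet_mean_breakdown\<close>): let a fraction of at least \<open>p\<close> of
  the sample lie within \<open>r\<close> of \<open>m\<close>, and compare the empirical objective at its minimiser \<open>q\<close>
  with its value at \<open>m\<close>. Write \<open>s = dist m q\<close>. Since \<open>\<tau>\<close> is \<open>D\<close>-Lipschitz, moving from \<open>m\<close> to
  \<open>q\<close> lowers the cost of any sample point by at most \<open>D s\<close>. For a point near \<open>m\<close> the cost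
  instead rises from at most \<open>\<tau> r \<le> D r\<close> to at least \<open>\<tau> (s - r)\<close>. By convexity, the hypothesis
  \<open>\<tau> R \<ge> \<lambda> D R\<close> propagates to the right of \<open>R\<close>, so this is at least \<open>\<lambda> D (s - r)\<close> as soon as
  \<open>s \<ge> r + R\<close>. As \<open>q\<close> costs no more than \<open>m\<close>, either \<open>s \<le> r + R\<close> or
  \<open>p (\<lambda> (s - r) - r) \<le> (1 - p) s\<close>, that is, \<open>s \<le> (1 + \<lambda>) p r / ((1 + \<lambda>) p - 1)\<close>. For
  \<open>r \<ge> R / 2\<close> and \<open>p = \<eta> \<rho>\<close>, both alternatives imply the radius claimed in the theorem: it
  equals \<open>(1 + 2 p / ((1 + \<lambda>) p - 1)) r\<close>, where \<open>2 p / ((1 + \<lambda>) p - 1)\<close> is at least \<open>2\<close>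
  because \<open>\<lambda> p \<le> 1\<close>, and where \<open>2 p \<ge> (1 + \<lambda>) p > 1\<close> because \<open>\<lambda> \<le> 1\<close>.

  Hence, for \<open>n > 0\<close>, \<open>m_n\<close> can only leave that radius if fewer than \<open>\<eta> \<rho> n\<close> of the sample points fall into
  the closed ball of radius \<open>r\<close> around \<open>m\<close>. The sample points fall into it independently, each
  with probability \<open>\<rho>\<close>, and Chernoff's exponential moment bound for the lower tail (lemma \<open>chernoff_hit_count\<close>)
  is exactly the relative entropy bound. For \<open>n = 0\<close> the right-hand side is \<open>1\<close>.
\<close>

section \<open>Growth of the transformation\<close>

lemma S0_plus_deriv:
  assumes "\<tau> \<in> S0_plus" "x > 0"
  shows "(\<tau> has_real_derivative deriv \<tau> x) (at x)"
  using assms by (auto simp: S0_plus_def DERIV_deriv_iff_real_differentiable)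

lemma S0_plus_above_tangent:
  assumes "\<tau> \<in> S0_plus" "x > 0" "y \<ge> 0"
  shows "\<tau> x + deriv \<tau> x * (y - x) \<le> \<tau> y"
proof -
  have "convex_on {0..} \<tau>"
    using assms(1) by (simp add: S0_plus_def)
  moreover have "(\<tau> has_real_derivative deriv \<tau> x) (at x within {0..})"
    using S0_plus_deriv[OF assms(1,2)] by (rule has_field_derivative_at_within)
  ultimately have "deriv \<tau> x * (y - x) \<le> \<tau> y - \<tau> x"
    using assms(2,3) by (intro convex_on_imp_above_tangent[of "{0..}"]) auto
  then show ?thesis by simp
qed

text \<open>
  Comparing the tangents at two points shows that the derivative is nondecreasing; it therefore
  stays below its limit.
\<close>

lemma S0_plus_deriv_le_limit:
  assumes "\<tau> \<in> S0_plus" "(deriv \<tau> \<longlongrightarrow> D) at_top" "x > 0"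
  shows "deriv \<tau> x \<le> D"
proof (rule tendsto_lowerbound[OF assms(2)])
  have "deriv \<tau> x \<le> deriv \<tau> y" if "y > x" for y
  proof -
    have "deriv \<tau> x * (y - x) \<le> deriv \<tau> y * (y - x)"
      using S0_plus_above_tangent[OF assms(1,3), of y]
        S0_plus_above_tangent[OF assms(1), of y x] that assms(3)
      by (simp add: algebra_simps)
    then show ?thesis using that by simp
  qed
  then show "\<forall>\<^sub>F y in at_top. deriv \<tau> x \<le> deriv \<tau> y"
    by (rule eventually_mono[OF eventually_gt_at_top])
qed simp

lemma S0_plus_limit_pos:
  assumes "\<tau> \<in> S0_plus" "(deriv \<tau> \<longlongrightarrow> D) at_top"
  shows "D > 0"
proof -
  have "0 < deriv \<tau> 1"
    using assms(1) by (simp add: S0_plus_def)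
  also have "\<dots> \<le> D"
    using S0_plus_deriv_le_limit[OF assms] by simp
  finally show ?thesis .
qed

text \<open>
  The tangent at the right end point \<open>b\<close> already lies below \<open>\<tau> a\<close>. This covers
  \<open>a = 0\<close> without a discussion of continuity there.
\<close>

lemma S0_plus_increment_le:
  assumes "\<tau> \<in> S0_plus" "(deriv \<tau> \<longlongrightarrow> D) at_top" "0 \<le> a" "a \<le> b"
  shows "\<tau> b - \<tau> a \<le> D * (b - a)"
proof (cases "b = 0")
  case False
  then have "b > 0" using assms(3,4) by simp
  then have "\<tau> b - \<tau> a \<le> deriv \<tau> b * (b - a)"
    using S0_plus_above_tangent[OF assms(1) _ assms(3), of b] by (simp add: algebra_simps)
  also have "\<dots> \<le> D * (b - a)"
    using S0_plus_deriv_le_limit[OF assms(1,2) \<open>b > 0\<close>] assms(4)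
    by (intro mult_right_mono) auto
  finally show ?thesis .
qed (use assms in auto)

text \<open>
  For convex \<open>\<tau>\<close> with \<open>\<tau> 0 = 0\<close>, the ratio \<open>\<tau> x / x\<close> is nondecreasing: write \<open>R\<close> as a convex
  combination of \<open>0\<close> and \<open>x\<close>.
\<close>

lemma S0_plus_linear_lower_bound:
  assumes "\<tau> \<in> S0_plus" "R > 0" "c * R \<le> \<tau> R" "R \<le> x"
  shows "c * x \<le> \<tau> x"
proof -
  have conv: "convex_on {0..} \<tau>" and "\<tau> 0 = 0"
    using assms(1) by (auto simp: S0_plus_def)
  have "x > 0" using assms by simp
  have "\<tau> ((1 - R / x) *\<^sub>R 0 + (R / x) *\<^sub>R x) \<le> (1 - R / x) * \<tau> 0 + (R / x) * \<tau> x"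
    using assms \<open>x > 0\<close> by (intro convex_onD[OF conv]) auto
  then have "\<tau> R \<le> (R / x) * \<tau> x"
    using \<open>x > 0\<close> \<open>\<tau> 0 = 0\<close> by simp
  with assms(3) have "c * R \<le> (R / x) * \<tau> x" by simp
  then have "R * (c * x) \<le> R * \<tau> x"
    using \<open>x > 0\<close> by (simp add: field_simps)
  then show ?thesis using assms(2) by simp
qed

section \<open>Robustness of the empirical Frechet mean\<close>

text \<open>
  The near points, a fraction of at least \<open>p\<close>, outvote the far ones: once \<open>q\<close> is more than
  \<open>r + R\<close> away from \<open>m\<close>, each near point penalises the move from \<open>m\<close> to \<open>q\<close> with slope about
  \<open>\<lambda> D\<close>, while each far point rewards it with slope at most \<open>D\<close>. The condition
  \<open>(1 + \<lambda>) p > 1\<close> says that \<open>\<lambda> p\<close> exceeds \<open>1 - p\<close>, so that the penalty dominates at large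
  distances.
\<close>

lemma empirical_frechet_mean_breakdown:
  fixes y :: "nat \<Rightarrow> 'a::metric_space"
  assumes tau: "\<tau> \<in> S0_plus" and D: "(deriv \<tau> \<longlongrightarrow> D) at_top"
    and mean: "is_empirical_frechet_mean \<tau> n y q"
    and R: "R > 0" "lam * D * R \<le> \<tau> R"
    and "r \<ge> 0" "n > 0" "lam \<ge> 0"
    and frac: "p * real n \<le> real (card {j\<in>{1..n}. dist (y j) m \<le> r})"
    and p: "(1 + lam) * p > 1"
  shows "dist m q \<le> max (r + R) ((1 + lam) * p / ((1 + lam) * p - 1) * r)"
proof (cases "dist m q \<le> r + R")
  case False
  define s where "s = dist m q"
  define near where "near = {j\<in>{1..n}. dist (y j) m \<le> r}"
  define K where "K = real (card near)"
  have s: "s > r + R" using False by (simp add: s_def)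
  have D_pos: "D > 0" by (rule S0_plus_limit_pos[OF tau D])
  have mono: "\<tau> a \<le> \<tau> b" if "0 \<le> a" "a \<le> b" for a b
    using tau that by (auto simp: S0_plus_def mono_on_def)
  have tau0: "\<tau> 0 = 0" using tau by (simp add: S0_plus_def)
  have near_gain: "D * (lam * (s - r) - r) \<le> \<tau> (dist (y j) q) - \<tau> (dist (y j) m)"
    if "j \<in> near" for j
  proof -
    have dj: "dist (y j) m \<le> r" using that by (simp add: near_def)
    have "s - r \<le> dist (y j) q"
      using dist_triangle[of m q "y j"] dj by (simp add: s_def dist_commute)
    then have "\<tau> (s - r) \<le> \<tau> (dist (y j) q)"
      using s R(1) by (intro mono) auto
    moreover have "lam * D * (s - r) \<le> \<tau> (s - r)"
      using s by (intro S0_plus_linear_lower_bound[OF tau R]) auto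
    moreover have "\<tau> (dist (y j) m) \<le> \<tau> r"
      using dj by (intro mono) auto
    moreover have "\<tau> r \<le> D * r"
      using S0_plus_increment_le[OF tau D, of 0 r] \<open>r \<ge> 0\<close> tau0 by simp
    ultimately show ?thesis by (simp add: algebra_simps)
  qed
  have far_loss: "- (D * s) \<le> \<tau> (dist (y j) q) - \<tau> (dist (y j) m)" for j
  proof (cases "dist (y j) q \<le> dist (y j) m")
    case True
    have "\<tau> (dist (y j) m) - \<tau> (dist (y j) q) \<le> D * (dist (y j) m - dist (y j) q)"
      using True by (intro S0_plus_increment_le[OF tau D]) auto
    also have "\<dots> \<le> D * s"
      using dist_triangle[of "y j" m q] D_pos
      by (intro mult_left_mono) (auto simp: s_def dist_commute)
    finally show ?thesis by simp
  next
    case False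
    then have "\<tau> (dist (y j) m) \<le> \<tau> (dist (y j) q)" by (intro mono) auto
    moreover have "0 \<le> D * s" using D_pos by (simp add: s_def)
    ultimately show ?thesis by simp
  qed
  have near: "near \<subseteq> {1..n}" by (auto simp: near_def)
  have "card ({1..n} - near) = n - card near"
    using near by (simp add: card_Diff_subset finite_subset)
  moreover have "card near \<le> n"
    using card_mono[OF _ near] by simp
  ultimately have far_card: "real (card ({1..n} - near)) = n - K"
    by (simp add: K_def)
  have "(\<Sum>j\<in>{1..n}. \<tau> (dist (y j) q)) \<le> (\<Sum>j\<in>{1..n}. \<tau> (dist (y j) m))"
    using mean by (auto simp: is_empirical_frechet_mean_def is_arg_min_def not_less)
  then have "0 \<ge> (\<Sum>j\<in>{1..n}. \<tau> (dist (y j) q) - \<tau> (dist (y j) m))"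
    by (simp add: sum_subtractf)
  also have "(\<Sum>j\<in>{1..n}. \<tau> (dist (y j) q) - \<tau> (dist (y j) m))
      = (\<Sum>j\<in>{1..n} - near. \<tau> (dist (y j) q) - \<tau> (dist (y j) m))
        + (\<Sum>j\<in>near. \<tau> (dist (y j) q) - \<tau> (dist (y j) m))"
    using near by (intro sum.subset_diff) auto
  also have "\<dots> \<ge> (\<Sum>j\<in>{1..n} - near. - (D * s)) + (\<Sum>j\<in>near. D * (lam * (s - r) - r))"
    by (intro add_mono sum_mono near_gain far_loss)
  also have "(\<Sum>j\<in>{1..n} - near. - (D * s)) + (\<Sum>j\<in>near. D * (lam * (s - r) - r))
      = D * (K * (lam * (s - r) - r) - (n - K) * s)"
    unfolding sum_constant far_card K_def by (simp add: algebra_simps)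
  finally have "D * (K * (lam * (s - r) - r) - (n - K) * s) \<le> 0" .
  then have "K * (lam * (s - r) - r) - (n - K) * s \<le> 0"
    using D_pos by (simp add: mult_le_0_iff)
  then have "K * ((1 + lam) * (s - r)) \<le> n * s"
    by (simp add: algebra_simps)
  \<comment> \<open>The factor \<open>s - r\<close> is positive, so the actual number \<open>K\<close> of near points can be replaced by
    its lower bound \<open>p n\<close>.\<close>
  moreover have "p * n * ((1 + lam) * (s - r)) \<le> K * ((1 + lam) * (s - r))"
    using frac s R(1) \<open>lam \<ge> 0\<close>
    by (intro mult_right_mono) (auto simp: K_def near_def)
  ultimately have "n * (p * ((1 + lam) * (s - r))) \<le> n * s"
    by (simp add: mult_ac)
  then have "p * ((1 + lam) * (s - r)) \<le> s"
    using \<open>n > 0\<close> by simp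
  then have "s * ((1 + lam) * p - 1) \<le> (1 + lam) * p * r"
    by (simp add: algebra_simps)
  then have "s \<le> (1 + lam) * p / ((1 + lam) * p - 1) * r"
    using p by (simp add: pos_le_divide_eq)
  then show ?thesis by (simp add: s_def)
qed simp

section \<open>The lower tail of a binomial count\<close>

text \<open>
  For a binomial variable \<open>S\<close> with parameters \<open>n\<close> and \<open>p\<close>, the moment \<open>E w^S\<close> is
  \<open>(1 - p + p w)^n\<close>, so the right-hand side is the bound that Markov's inequality for \<open>w^S\<close>
  gives on the probability of \<open>S < t n\<close> when \<open>w \<le> 1\<close>, that is, when \<open>t \<le> p\<close>.
  The chosen \<open>w\<close> minimises that bound; it is the odds ratio that tilts the success probability from \<open>p\<close> to \<open>t\<close>.
\<close>

lemma ereal_exp_neg_KL: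
  assumes "0 < t" "t < 1" "0 < p" "p < 1"
  defines "w \<equiv> t * (1 - p) / (p * (1 - t))"
  shows "ereal_exp (- (ereal (real n) * KL t p))
    = ereal ((1 - p + p * w) ^ n / w powr (t * n))"
proof -
  have w: "w > 0" using assms by (simp add: w_def)
  have mean: "1 - p + p * w = (1 - p) / (1 - t)"
    using assms by (simp add: w_def field_simps)
  have "t * ln (t / p) + (1 - t) * ln ((1 - t) / (1 - p)) = t * ln w - ln (1 - p + p * w)"
  proof -
    have "ln w = ln t + ln (1 - p) - (ln p + ln (1 - t))"
      using assms(1-4) by (simp add: w_def ln_div ln_mult)
    then show ?thesis
      unfolding mean using assms(1-4) by (simp add: ln_div) (simp add: algebra_simps)
  qed
  then have KL: "KL t p = ereal (t * ln w - ln (1 - p + p * w))"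
    using assms by (simp add: KL_def)
  have "0 < 1 - p + p * w"
    unfolding mean using assms by simp
  then have "(1 - p + p * w) ^ n = exp (n * ln (1 - p + p * w))"
    by (simp add: exp_of_nat_mult)
  then show ?thesis
    using w by (simp add: KL ereal_exp_def powr_def algebra_simps flip: exp_diff)
qed

text \<open>
  For \<open>p < 1\<close>, a hit contributes the factor \<open>w \<le> 1\<close> and a miss the factor \<open>1\<close>, so that few hits
  make the product large, and Markov's inequality applies. For \<open>p = 1\<close> there is
  no positive tilt to use; then misses are null events, and the event is null, since having fewer
  than \<open>t \<cdot> card I \<le> card I\<close> hits forces a miss.
\<close>

lemma (in prob_space) chernoff_hit_count:
  fixes X :: "'i \<Rightarrow> 'a \<Rightarrow> 'c"
  assumes fin: "finite I"
    and indep: "indep_vars (\<lambda>_. N) X I"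
    and B: "B \<in> sets N"
    and p: "\<And>i. i \<in> I \<Longrightarrow> prob {\<omega> \<in> space M. X i \<omega> \<in> B} = p" "p \<le> 1"
    and t: "0 < t" "t \<le> p"
  shows "ereal (prob {\<omega> \<in> space M. real (card {i\<in>I. X i \<omega> \<in> B}) < t * real (card I)})
    \<le> ereal_exp (- (ereal (real (card I)) * KL t p))"
proof -
  define E where "E = {\<omega> \<in> space M. real (card {i\<in>I. X i \<omega> \<in> B}) < t * real (card I)}"
  have X [measurable]: "X i \<in> measurable M N" if "i \<in> I" for i
    using indep that by (auto simp: indep_vars_def)
  have hit: "{\<omega> \<in> space M. X i \<omega> \<in> B} \<in> events" if "i \<in> I" for i
    using X[OF that] B by measurable
  show ?thesis
  proof (cases "p = 1")
    case True
    have miss_null: "prob {\<omega> \<in> space M. X i \<omega> \<notin> B} = 0" if "i \<in> I" for i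
      using prob_neg[OF hit[OF that]] p(1)[OF that] True by simp
    have "E \<subseteq> (\<Union>i\<in>I. {\<omega> \<in> space M. X i \<omega> \<notin> B})"
    proof
      fix \<omega> assume E: "\<omega> \<in> E"
      have "\<exists>i\<in>I. X i \<omega> \<notin> B"
      proof (rule ccontr)
        assume "\<not> ?thesis"
        then have "{i\<in>I. X i \<omega> \<in> B} = I" by auto
        then have "real (card I) < t * real (card I)" using E by (simp add: E_def)
        moreover have "t * real (card I) \<le> 1 * real (card I)"
          using t p(2) by (intro mult_right_mono) auto
        ultimately show False by simp
      qed
      then show "\<omega> \<in> (\<Union>i\<in>I. {\<omega> \<in> space M. X i \<omega> \<notin> B})" using E by (auto simp: E_def)
    qed
    moreover have miss: "{\<omega> \<in> space M. X i \<omega> \<notin> B} \<in> events" if "i \<in> I" for i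
      using X[OF that] B by measurable
    ultimately have "prob E \<le> prob (\<Union>i\<in>I. {\<omega> \<in> space M. X i \<omega> \<notin> B})"
      using fin by (intro finite_measure_mono) auto
    also have "\<dots> \<le> (\<Sum>i\<in>I. prob {\<omega> \<in> space M. X i \<omega> \<notin> B})"
      using fin miss by (intro finite_measure_subadditive_finite) auto
    also have "\<dots> = 0" using miss_null by simp
    finally have "prob E \<le> 0" .
    then have "ereal (prob E) \<le> 0" by simp
    also have "0 \<le> ereal_exp x" for x
      by (cases x) (auto simp: ereal_exp_def)
    finally show ?thesis by (simp add: E_def)
  next
    case False
    with p(2) t have p01: "0 < p" "p < 1" and t1: "t < 1" by auto
    define w where "w = t * (1 - p) / (p * (1 - t))"
    have w: "0 < w" "w \<le> 1"
      using p01 t t1 by (auto simp: w_def field_simps)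
    define f where "f = (\<lambda>x. if x \<in> B then w else 1)"
    have f_meas [measurable]: "f \<in> borel_measurable N"
      unfolding f_def using B by measurable
    have f_bd: "0 < f x" "f x \<le> 1" for x using w by (auto simp: f_def)
    have int: "integrable M (\<lambda>\<omega>. f (X i \<omega>))" if "i \<in> I" for i
      using X[OF that] f_bd
      by (intro integrable_const_bound[where B=1]) (auto simp: less_imp_le intro: measurable_compose[OF _ f_meas])
    have indep_f: "indep_vars (\<lambda>_. borel) (\<lambda>i \<omega>. f (X i \<omega>)) I"
      using indep by (rule indep_vars_compose2) simp
    have Ef: "expectation (\<lambda>\<omega>. f (X i \<omega>)) = 1 - p + p * w" if "i \<in> I" for i
    proof -
      let ?A = "{\<omega> \<in> space M. X i \<omega> \<in> B}"
      have "expectation (\<lambda>\<omega>. f (X i \<omega>)) = expectation (\<lambda>\<omega>. 1 - (1 - w) * indicator ?A \<omega>)"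
        by (intro Bochner_Integration.integral_cong) (auto simp: f_def)
      also have "\<dots> = 1 - (1 - w) * prob ?A"
        using hit[OF that] by (simp add: prob_space emeasure_eq_measure)
      finally show ?thesis using p(1)[OF that] by (simp add: algebra_simps)
    qed
    have prod_int: "integrable M (\<lambda>\<omega>. \<Prod>i\<in>I. f (X i \<omega>))"
      using indep_f int by (intro indep_vars_integrable fin)
    have prod_E: "expectation (\<lambda>\<omega>. \<Prod>i\<in>I. f (X i \<omega>)) = (1 - p + p * w) ^ card I"
      using indep_vars_lebesgue_integral[OF fin indep_f int] Ef by simp
    have prod_f: "(\<Prod>i\<in>I. f (X i \<omega>)) = w ^ card {i\<in>I. X i \<omega> \<in> B}" for \<omega>
      using fin by (simp add: f_def prod.If_cases Int_def conj_commute)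
    have "E \<subseteq> {\<omega> \<in> space M. w powr (t * real (card I)) \<le> (\<Prod>i\<in>I. f (X i \<omega>))}"
    proof
      fix \<omega> assume "\<omega> \<in> E"
      then show "\<omega> \<in> {\<omega> \<in> space M. w powr (t * real (card I)) \<le> (\<Prod>i\<in>I. f (X i \<omega>))}"
        unfolding prod_f using w by (auto simp: E_def powr_mono' simp flip: powr_realpow)
    qed
    moreover have "{\<omega> \<in> space M. w powr (t * real (card I)) \<le> (\<Prod>i\<in>I. f (X i \<omega>))} \<in> events"
      using borel_measurable_integrable[OF prod_int] by measurable
    ultimately have "prob E \<le> prob {\<omega> \<in> space M. w powr (t * real (card I)) \<le> (\<Prod>i\<in>I. f (X i \<omega>))}"
      by (rule finite_measure_mono)
    also have "\<dots> \<le> (1 - p + p * w) ^ card I / w powr (t * real (card I))"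
      using integral_Markov_inequality_measure[OF prod_int, of "{}" "w powr (t * real (card I))"]
        w f_bd prod_E by (auto simp: prod_nonneg less_imp_le)
    finally show ?thesis
      using ereal_exp_neg_KL[OF t(1) t1 p01] by (simp add: E_def w_def)
  qed
qed

section \<open>Concentration of the empirical Frechet mean\<close>

theorem theorem4p8:
  fixes M :: "'b measure"
    and \<tau> :: "real \<Rightarrow> real"
    and Y :: "'b \<Rightarrow> 'a::hadamard_space"
    and Ys :: "nat \<Rightarrow> 'b \<Rightarrow> 'a"
    and h :: "(nat \<Rightarrow> 'a) \<Rightarrow> 'a"
    and m_n :: "'b \<Rightarrow> 'a"
    and m z :: 'a
    and n :: nat
    and D R lam r \<rho> \<eta> :: real
  assumes "prob_space M"
    and "\<tau> \<in> S0_plus"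
    and "(deriv \<tau> \<longlongrightarrow> D) at_top"
    and "Y \<in> borel_measurable M"
    and "concentrated_on_separable M Y"
    and "is_frechet_mean M \<tau> z Y m"
    and "prob_space.indep_vars M (\<lambda>_. borel) Ys {1..n}"
    and "\<And>j. j \<in> {1..n} \<Longrightarrow> distr M borel (Ys j) = distr M borel Y"
    and "h \<in> borel_measurable (Pi\<^sub>M {1..n} (\<lambda>_. borel))"
    and "\<And>\<omega>. \<omega> \<in> space M \<Longrightarrow> m_n \<omega> = h (\<lambda>j\<in>{1..n}. Ys j \<omega>)"
    and "\<And>\<omega>. \<omega> \<in> space M \<Longrightarrow> is_empirical_frechet_mean \<tau> n (\<lambda>j. Ys j \<omega>) (m_n \<omega>)"
    and "R > 0"
    and "0 < lam" "lam \<le> 1"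
    and "\<tau> R \<ge> lam * D * R"
    and "r \<ge> 0"
    and "\<rho> = measure M {\<omega> \<in> space M. dist (Y \<omega>) m \<le> r}"
    and "0 < \<eta>" "\<eta> \<le> 1"
    and "(lam + 1) * \<eta> * \<rho> > 1"
    and "r \<ge> 1/2 * R"
  shows "ereal (measure M {\<omega> \<in> space M.
           dist m (m_n \<omega>) > ((3 + lam) * \<eta> * \<rho> - 1) / ((1 + lam) * \<eta> * \<rho> - 1) * r})
         \<le> ereal_exp (- (ereal (real n) * KL (\<eta> * \<rho>) \<rho>))"
proof -
  interpret prob_space M by fact
  define t where "t = \<eta> * \<rho>"
  have "\<rho> \<le> 1" using assms(17) by simp
  have t_gt: "(1 + lam) * t > 1"
    using assms(20) by (simp add: t_def algebra_simps)
  then have t_pos: "t > 0"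
    using \<open>0 < lam\<close> by (smt (verit) mult_nonneg_nonpos)
  have "\<rho> > 0" using t_pos \<open>0 < \<eta>\<close> by (simp add: t_def zero_less_mult_iff)
  then have t_le: "t \<le> \<rho>" using \<open>\<eta> \<le> 1\<close> by (simp add: t_def)
  have ratio: "((3 + lam) * \<eta> * \<rho> - 1) / ((1 + lam) * \<eta> * \<rho> - 1)
      = ((3 + lam) * t - 1) / ((1 + lam) * t - 1)"
    by (simp add: t_def mult.assoc)
  have hit_prob: "prob {\<omega> \<in> space M. Ys j \<omega> \<in> cball m r} = \<rho>" if "j \<in> {1..n}" for j
  proof -
    have Ysj: "Ys j \<in> borel_measurable M"
      using assms(7) that by (auto simp: indep_vars_def)
    have "prob {\<omega> \<in> space M. Ys j \<omega> \<in> cball m r} = measure (distr M borel (Ys j)) (cball m r)"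
      using Ysj by (subst measure_distr) (auto intro!: arg_cong[where f=prob])
    also have "\<dots> = measure (distr M borel Y) (cball m r)"
      using assms(8)[OF that] by simp
    also have "\<dots> = \<rho>"
      unfolding assms(17) using assms(4)
      by (subst measure_distr) (auto intro!: arg_cong[where f=prob] simp: dist_commute)
    finally show ?thesis .
  qed
  \<comment> \<open>the exceptional event outside of which the deterministic bound applies\<close>
  define few where
    "few = {\<omega> \<in> space M. real (card {j\<in>{1..n}. Ys j \<omega> \<in> cball m r}) < t * real n}"
  have chernoff: "ereal (prob few) \<le> ereal_exp (- (ereal (real n) * KL t \<rho>))"
    using chernoff_hit_count[OF _ assms(7) _ hit_prob \<open>\<rho> \<le> 1\<close> t_pos t_le]
    by (simp add: few_def)
  show ?thesis
  proof (cases "n = 0")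
    case True
    then have "ereal_exp (- (ereal (real n) * KL (\<eta> * \<rho>) \<rho>)) = 1"
      by (simp add: ereal_exp_def flip: zero_ereal_def)
        (simp add: zero_ereal_def one_ereal_def)
    then show ?thesis by simp
  next
    case False
    have "dist m (m_n \<omega>) \<le> ((3 + lam) * t - 1) / ((1 + lam) * t - 1) * r"
      if \<omega>: "\<omega> \<in> space M" "\<omega> \<notin> few" for \<omega>
    proof -
      have "t * real n \<le> real (card {j\<in>{1..n}. dist (Ys j \<omega>) m \<le> r})"
        using \<omega> by (simp add: few_def dist_commute not_less)
      then have bound: "dist m (m_n \<omega>) \<le> max (r + R) ((1 + lam) * t / ((1 + lam) * t - 1) * r)"
        using assms False t_gt
        by (intro empirical_frechet_mean_breakdown[OF assms(2,3) assms(11)[OF \<omega>(1)]]) auto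
      \<comment> \<open>The stated radius is at least \<open>3 r \<ge> r + R\<close>, the first alternative in \<open>bound\<close>.\<close>
      have "lam * t \<le> 1"
        using \<open>lam \<le> 1\<close> \<open>0 < lam\<close> t_pos t_le \<open>\<rho> \<le> 1\<close> by (intro mult_le_one) auto
      then have "3 \<le> ((3 + lam) * t - 1) / ((1 + lam) * t - 1)"
        using t_gt by (simp add: pos_le_divide_eq algebra_simps)
      then have "3 * r \<le> ((3 + lam) * t - 1) / ((1 + lam) * t - 1) * r"
        using \<open>r \<ge> 0\<close> by (rule mult_right_mono)
      \<comment> \<open>It is also at least the second alternative, since \<open>2 t \<ge> (1 + lam) t > 1\<close>.\<close>
      moreover have "lam * t \<le> t" using \<open>lam \<le> 1\<close> t_pos by simp
      then have "1 \<le> 2 * t" using t_gt by (simp add: algebra_simps)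
      then have "(1 + lam) * t \<le> (3 + lam) * t - 1" by (simp add: algebra_simps)
      then have "(1 + lam) * t / ((1 + lam) * t - 1) * r
          \<le> ((3 + lam) * t - 1) / ((1 + lam) * t - 1) * r"
        using t_gt \<open>r \<ge> 0\<close> by (intro mult_right_mono divide_right_mono) auto
      ultimately show ?thesis using bound \<open>r \<ge> 1/2 * R\<close> by linarith
    qed
    then have "{\<omega> \<in> space M. dist m (m_n \<omega>) > ((3 + lam) * t - 1) / ((1 + lam) * t - 1) * r} \<subseteq> few"
      by (force simp: not_less)
    moreover have "few \<in> events"
    proof -
      \<comment> \<open>A set of positive measure is measurable, because \<open>measure\<close> vanishes on all other sets.\<close>
      have hit: "{\<omega> \<in> space M. Ys j \<omega> \<in> cball m r} \<in> events" if "j \<in> {1..n}" for j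
        using hit_prob[OF that] \<open>\<rho> > 0\<close> by (metis less_irrefl measure_notin_sets)
      define hits where
        "hits = (\<lambda>\<omega>. \<Sum>j\<in>{1..n}. indicat_real {\<omega> \<in> space M. Ys j \<omega> \<in> cball m r} \<omega>)"
      have [measurable]: "hits \<in> borel_measurable M"
        unfolding hits_def using hit by (intro borel_measurable_sum borel_measurable_indicator) auto
      have "hits \<omega> = real (card {j\<in>{1..n}. Ys j \<omega> \<in> cball m r})" if "\<omega> \<in> space M" for \<omega>
        using that by (simp add: hits_def indicator_def sum.If_cases Int_def)
      then have "few = {\<omega> \<in> space M. hits \<omega> < t * real n}"
        unfolding few_def by (intro Collect_cong conj_cong refl) simp
      then show ?thesis by simp
    qed
    ultimately have "prob {\<omega> \<in> space M. dist m (m_n \<omega>) > ((3 + lam) * t - 1) / ((1 + lam) * t - 1) * r}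
        \<le> prob few"
      by (rule finite_measure_mono)
    then have "ereal (prob {\<omega> \<in> space M. dist m (m_n \<omega>) > ((3 + lam) * t - 1) / ((1 + lam) * t - 1) * r})
        \<le> ereal (prob few)" by simp
    also note chernoff
    finally show ?thesis unfolding ratio t_def .
  qed
qed

end
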